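(* Let $\mathcal T$ be an SIP-tree, drawn so that $i_c=1$ for each stage $c$. For $r=1,\dots,n$ let $m_r\in\mathbb R[\Theta,z]$ be the monomial obtained from $$z^{d-d(\lambda_r)}\prod_{e\in E(\lambda_r)}\theta(e)$$ by substituting the first parameter (the label of the first outgoing edge) of each stage by $z$. Then $\ker\varphi_{\mathcal T}$ is toric after a linear change of variables with parametrisation given by $m_1,\dots,m_n$; that is, there is a basis $\ell_1,\dots,\ell_n$ of the space of linear forms of $\mathbb R[p_1,\dots,p_n]$ such that $\ker\varphi_{\mathcal T}$ is the kernel of the $\mathbb R$-algebra map $\mathbb R[p_1,\dots,p_n]=\mathbb R[\ell_1,\dots,\ell_n]\to\mathbb R[\Theta,z]$, $\ell_r\mapsto m_r$. Moreover, $p_1+\dots+p_n$ is one of the new variables $\ell_1,\dots,\ell_n$.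
   Context: A staged tree $\mathcal T$ is a finite rooted tree, edges directed away from the root, with an equivalence relation $\sim$ on vertices (classes are called stages or colours) and edge labels $\theta(e)$ such that: the outgoing edges of an inner vertex have pairwise distinct labels; inner vertices in the same stage have the same set of outgoing edge labels; inner vertices in different stages have disjoint sets of outgoing labels; leaves are (by convention) all in the same stage. Labels stand for probabilities in $(0,1)$ summing to one at each inner vertex, so each inner vertex has at least two children. The children of a vertex $v$ are written $v_1,\dots,v_k$, ordered such that if $u\sim v$ is a stage with labels $\theta_1,\dots,\theta_k$, then the edges $(u,u_i)$ and $(v,v_i)$ both have label $\theta_i$. $\lambda_1,\dots,\lambda_n$ are the root-to-leaf paths, $E(\lambda_r)$ is the set of edges of $\lambda_r$, $d(\lambda_r)=|E(\lambda_r)|$, and $d=\max_r d(\lambda_r)$. Treat the set $\Theta$ of labels as variables, let $z$ be one extra variable, and let $\langle\theta-z\rangle\subset\mathbb R[\Theta,z]$ be the ideal generated by $\sum_{e\in E(v)}\theta(e)-z$ for all inner vertices $v$, where $E(v)$ is the set of outgoing edges of $v$. Define the $\mathbb R$-algebra map $$\varphi_{\mathcal T}:\mathbb R[p_1,\dots,p_n]\to\mathbb R[\Theta,z]/\langle\theta-z\rangle,\qquad p_r\mapsto z^{d-d(\lambda_r)}\prod_{e\in E(\lambda_r)}\theta(e).$$ $\mathcal T(v)$ denotes the induced subtree of $\mathcal T$ rooted at $v$ (all vertices below $v$, with their labels and stages). A stage $c$ (of inner vertices) has the subtree-inclusion property (SIP) if there is an index $i_c$ such that for every vertex $v$ of stage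 $c$ and every child $v_i$ of $v$, the tree $\mathcal T(v_i)$ contains a subtree with root $v_i$ that is identical (as a labelled rooted tree) to $\mathcal T(v_{i_c})$. An SIP-tree is a staged tree all of whose stages have the subtree-inclusion property. By reordering the outgoing edges of each stage one can always arrange $i_c=1$ for all stages $c$. *)

theory Defs
  imports Complex_Main "HOL-Algebra.QuotRing" "HOL-Library.Poly_Mapping"
begin

type_synonym 'v mpoly = "('v \<Rightarrow>\<^sub>0 nat) \<Rightarrow>\<^sub>0 real"

definition Var :: "'v \<Rightarrow> 'v mpoly" where
  "Var v = Poly_Mapping.single (Poly_Mapping.single v 1) 1"

definition Const :: "real \<Rightarrow> 'v mpoly" where
  "Const a = Poly_Mapping.single 0 a"

definition vars :: "'v mpoly \<Rightarrow> 'v set" where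
  "vars f = (\<Union>m\<in>Poly_Mapping.keys f. Poly_Mapping.keys m)"

definition poly_subst :: "('v \<Rightarrow> 'w mpoly) \<Rightarrow> 'v mpoly \<Rightarrow> 'w mpoly" where
  "poly_subst g f =
     (\<Sum>m\<in>Poly_Mapping.keys f. Const (Poly_Mapping.lookup f m) *
        (\<Prod>v\<in>Poly_Mapping.keys m. g v ^ Poly_Mapping.lookup m v))"

definition poly_ring :: "'v set \<Rightarrow> 'v mpoly ring" where
  "poly_ring X =
     \<lparr>carrier = {f. vars f \<subseteq> X}, mult = (*), one = 1, zero = 0, add = (+)\<rparr>"

definition alg_hom :: "'v set \<Rightarrow> 'w set \<Rightarrow> ('v mpoly \<Rightarrow> 'w mpoly) \<Rightarrow> bool" where
  "alg_hom X Y \<psi> \<longleftrightarrow>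
     \<psi> \<in> ring_hom (poly_ring X) (poly_ring Y) \<and> (\<forall>a. \<psi> (Const a) = Const a)"

global_interpretation mpoly: vector_space "\<lambda>a (f :: 'v mpoly). Const a * f"
  by unfold_locales
    (simp_all add: Const_def algebra_simps single_add mult_single flip: mult.assoc)

definition linear_forms :: "'v set \<Rightarrow> 'v mpoly set" where
  "linear_forms X = mpoly.span (Var ` X)"

definition basis_family :: "nat \<Rightarrow> (nat \<Rightarrow> 'v mpoly) \<Rightarrow> 'v mpoly set \<Rightarrow> bool" where
  "basis_family n ell W \<longleftrightarrow>
     inj_on ell {..<n} \<and> mpoly.independent (ell ` {..<n}) \<and> mpoly.span (ell ` {..<n}) = W"

text \<open>
  Finite rooted trees with ordered children. An inner vertex carries its stage and the list of
  its outgoing edges, each given by its label and the subtree below it. The leaves, which carry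
  no data, form one further stage. A vertex \<open>v\<close> enters only through its induced subtree \<open>\<T>(v)\<close>.
\<close>

datatype ('c, 'l) tree = Leaf | Inner 'c "('l \<times> ('c, 'l) tree) list"

inductive_set subtrees :: "('c, 'l) tree \<Rightarrow> ('c, 'l) tree set" for T where
  root: "T \<in> subtrees T"
| child: "Inner c es \<in> subtrees T \<Longrightarrow> (l, t) \<in> set es \<Longrightarrow> t \<in> subtrees T"

text \<open>
  Equality of the two label lists in the third clause states both that vertices in the same
  stage have the same set of outgoing labels and that their children are ordered
  compatibly with these labels.
\<close>

definition staged_tree :: "('c, 'l) tree \<Rightarrow> bool" where
  "staged_tree T \<longleftrightarrow>
     (\<forall>c es. Inner c es \<in> subtrees T \<longrightarrow> length es \<ge> 2) \<and>
     (\<forall>c es. Inner c es \<in> subtrees T \<longrightarrow> distinct (map fst es)) \<and>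
     (\<forall>c es es'. Inner c es \<in> subtrees T \<and> Inner c es' \<in> subtrees T \<longrightarrow>
        map fst es = map fst es') \<and>
     (\<forall>c c' es es'. Inner c es \<in> subtrees T \<and> Inner c' es' \<in> subtrees T \<and> c \<noteq> c' \<longrightarrow>
        fst ` set es \<inter> fst ` set es' = {})"

definition inner_stages :: "('c, 'l) tree \<Rightarrow> 'c set" where
  "inner_stages T = {c. \<exists>es. Inner c es \<in> subtrees T}"

definition labels :: "('c, 'l) tree \<Rightarrow> 'l set" where
  "labels T = {l. \<exists>c es. Inner c es \<in> subtrees T \<and> l \<in> fst ` set es}"

definition first_labels :: "('c, 'l) tree \<Rightarrow> 'l set" where
  "first_labels T = {l. \<exists>c es. Inner c es \<in> subtrees T \<and> l = fst (hd es)}"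

text \<open>Root-to-leaf paths, each given by the labels of its successive edges.\<close>

fun paths :: "('c, 'l) tree \<Rightarrow> 'l list list" where
  "paths Leaf = [[]]"
| "paths (Inner c es) = concat (map (\<lambda>(l, t). map ((#) l) (paths t)) es)"

definition num_leaves :: "('c, 'l) tree \<Rightarrow> nat" where
  "num_leaves T = length (paths T)"

definition depth :: "('c, 'l) tree \<Rightarrow> nat" where
  "depth T = Max (length ` set (paths T))"

text \<open>
  \<open>contains_at_root t s\<close>: some subtree of \<open>t\<close> with the same root is identical to \<open>s\<close> as a
  labelled rooted tree. A leaf of \<open>s\<close> may sit at an inner vertex of \<open>t\<close>.
\<close>

inductive contains_at_root :: "('c, 'l) tree \<Rightarrow> ('c, 'l) tree \<Rightarrow> bool" where
  leaf: "contains_at_root t Leaf"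
| inner: "(\<And>l s. (l, s) \<in> set es \<Longrightarrow> \<exists>t. (l, t) \<in> set es' \<and> contains_at_root t s) \<Longrightarrow>
    contains_at_root (Inner c' es') (Inner c es)"

text \<open>Children are counted from 0, so drawing \<open>T\<close> with \<open>i\<^sub>c = 1\<close> is \<open>SIP_index T c 0\<close>.\<close>

definition SIP_index :: "('c, 'l) tree \<Rightarrow> 'c \<Rightarrow> nat \<Rightarrow> bool" where
  "SIP_index T c i \<longleftrightarrow>
     (\<forall>es. Inner c es \<in> subtrees T \<longrightarrow>
        i < length es \<and> (\<forall>(l, t)\<in>set es. contains_at_root t (snd (es ! i))))"

definition SIP_tree :: "('c, 'l) tree \<Rightarrow> bool" where
  "SIP_tree T \<longleftrightarrow> staged_tree T \<and> (\<forall>c\<in>inner_stages T. \<exists>i. SIP_index T c i)"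

datatype 'l indet = Theta 'l | Z

definition indets :: "('c, 'l) tree \<Rightarrow> 'l indet set" where
  "indets T = insert Z (Theta ` labels T)"

definition theta_ideal :: "('c, 'l) tree \<Rightarrow> 'l indet mpoly set" where
  "theta_ideal T =
     genideal (poly_ring (indets T))
       {(\<Sum>(l, t)\<leftarrow>es. Var (Theta l)) - Var Z |c es. Inner c es \<in> subtrees T}"

definition path_monomial :: "('c, 'l) tree \<Rightarrow> nat \<Rightarrow> 'l indet mpoly" where
  "path_monomial T r =
     Var Z ^ (depth T - length (paths T ! r)) * (\<Prod>l\<leftarrow>paths T ! r. Var (Theta l))"

text \<open>\<open>p\<^sub>1, \<dots>, p\<^sub>n\<close> are \<open>Var 0, \<dots>, Var (n - 1)\<close>.\<close>

definition tree_map :: "('c, 'l) tree \<Rightarrow> nat mpoly \<Rightarrow> 'l indet mpoly set" where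
  "tree_map T f =
     a_r_coset (poly_ring (indets T)) (theta_ideal T) (poly_subst (path_monomial T) f)"

definition tree_kernel :: "('c, 'l) tree \<Rightarrow> nat mpoly set" where
  "tree_kernel T =
     a_kernel (poly_ring {..<num_leaves T})
       (FactRing (poly_ring (indets T)) (theta_ideal T)) (tree_map T)"

definition toric_monomial :: "('c, 'l) tree \<Rightarrow> nat \<Rightarrow> 'l indet mpoly" where
  "toric_monomial T r =
     poly_subst
       (\<lambda>x. if x \<in> Theta ` first_labels T then Var Z else Var x)
       (path_monomial T r)"

end

theory Submission
  imports Defs
begin

text \<open>
  In each stage the condition that the outgoing labels sum to \<open>z\<close> can be solved for the first label.
  This identifies the quotient ring with a polynomial ring, and the kernel of \<open>\<phi>\<^sub>\<T>\<close> becomes the kernel of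
  the substitution \<open>p\<^sub>r \<mapsto> q\<^sub>r\<close>, where \<open>q\<^sub>r\<close> is the path monomial with the first labels eliminated
  (\<open>tree_kernel_eq\<close>). It is therefore enough to find a basis \<open>\<ell>\<^sub>r\<close> of the linear forms in the \<open>p\<^sub>r\<close> that
  this same substitution sends to the monomials \<open>m\<^sub>r\<close>.

  Such forms are built from the leaves to the root (\<open>monomial_forms\<close>). Let the root have edges with
  labels \<open>\<theta>\<^sub>1, \<dots>, \<theta>\<^sub>k\<close> to subtrees \<open>t\<^sub>1, \<dots>, t\<^sub>k\<close>. For \<open>i \<ge> 2\<close> the label \<open>\<theta>\<^sub>i\<close> is not eliminated, and the forms
  of \<open>t\<^sub>i\<close> already have the right values \<open>\<theta>\<^sub>i m\<close>. For \<open>i = 1\<close> they have the values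
  \<open>(z - \<theta>\<^sub>2 - \<dots> - \<theta>\<^sub>k) m\<close> instead of \<open>z m\<close>, so that linear forms with values \<open>\<theta>\<^sub>i m\<close> have to be added, for
  the monomials \<open>m\<close> of \<open>t\<^sub>1\<close>. This is where the subtree-inclusion property enters: a leaf of \<open>t\<^sub>1\<close> is a
  vertex of \<open>t\<^sub>i\<close>, and the sum of the forms of all paths of \<open>t\<^sub>i\<close> through this vertex has the value that
  the leaf would have in \<open>t\<^sub>1\<close>, because the path values below a vertex sum to a power of \<open>z\<close>
  (\<open>contains_at_root_liftable\<close>). The induction hypothesis for \<open>t\<^sub>1\<close>, applied to these sums, gives the
  missing forms, and they involve only the variables of \<open>t\<^sub>i\<close>.

  The resulting change of forms is block triangular, so the new forms still span, and \<open>n\<close> spanning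
  vectors of an \<open>n\<close>-dimensional space are a basis. Along the path of first labels each step adds up the
  sums of all branches, so the form of this path is the sum of all variables.
\<close>

section \<open>Substitution in polynomials\<close>

lemma Const_add: "Const (a + b) = Const a + Const b"
  by (simp add: Const_def single_add)

lemma Const_mult: "Const (a * b) = Const a * Const b"
  by (simp add: Const_def mult_single)

lemma Const_0 [simp]: "Const 0 = 0"
  by (simp add: Const_def)

lemma Const_1 [simp]: "Const 1 = 1"
  by (simp add: Const_def)

definition monom_value :: "('v \<Rightarrow> 'w mpoly) \<Rightarrow> ('v \<Rightarrow>\<^sub>0 nat) \<Rightarrow> 'w mpoly" where
  "monom_value g m = (\<Prod>v\<in>Poly_Mapping.keys m. g v ^ Poly_Mapping.lookup m v)"

lemma monom_value_superset:
  assumes "finite K" "Poly_Mapping.keys m \<subseteq> K"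
  shows "monom_value g m = (\<Prod>v\<in>K. g v ^ Poly_Mapping.lookup m v)"
  unfolding monom_value_def using assms
  by (intro prod.mono_neutral_left) (auto simp: in_keys_iff)

lemma monom_value_add: "monom_value g (m + m') = monom_value g m * monom_value g m'"
proof -
  let ?K = "Poly_Mapping.keys m \<union> Poly_Mapping.keys m'"
  have "Poly_Mapping.keys (m + m') \<subseteq> ?K" by (rule keys_add)
  then show ?thesis
    using monom_value_superset[of ?K m g] monom_value_superset[of ?K m' g]
      monom_value_superset[of ?K "m + m'" g]
    by (simp add: lookup_add power_add prod.distrib)
qed

lemma poly_subst_superset:
  assumes "finite K" "Poly_Mapping.keys f \<subseteq> K"
  shows "poly_subst g f = (\<Sum>m\<in>K. Const (Poly_Mapping.lookup f m) * monom_value g m)"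
  unfolding poly_subst_def monom_value_def[symmetric] using assms
  by (intro sum.mono_neutral_left) (auto simp: in_keys_iff)

lemma poly_subst_single: "poly_subst g (Poly_Mapping.single m a) = Const a * monom_value g m"
  using poly_subst_superset[of "{m}" "Poly_Mapping.single m a" g] by simp

lemma poly_subst_0 [simp]: "poly_subst g 0 = 0"
  by (simp add: poly_subst_def)

lemma poly_subst_Const [simp]: "poly_subst g (Const a) = Const a"
  by (simp add: Const_def poly_subst_single monom_value_def)

lemma poly_subst_1 [simp]: "poly_subst g 1 = 1"
  using poly_subst_Const[of g 1] by simp

lemma poly_subst_Var [simp]: "poly_subst g (Var v) = g v"
  by (simp add: Var_def poly_subst_single monom_value_def)

lemma poly_subst_add: "poly_subst g (f + h) = poly_subst g f + poly_subst g h"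
proof -
  let ?K = "Poly_Mapping.keys f \<union> Poly_Mapping.keys h"
  have "Poly_Mapping.keys (f + h) \<subseteq> ?K" by (rule keys_add)
  then show ?thesis
    using poly_subst_superset[of ?K f g] poly_subst_superset[of ?K h g]
      poly_subst_superset[of ?K "f + h" g]
    by (simp add: lookup_add Const_add distrib_right sum.distrib)
qed

lemma poly_subst_sum: "poly_subst g (\<Sum>x\<in>A. f x) = (\<Sum>x\<in>A. poly_subst g (f x))"
  by (induction A rule: infinite_finite_induct) (simp_all add: poly_subst_add)

lemma poly_subst_diff: "poly_subst g (f - h) = poly_subst g f - poly_subst g h"
  using poly_subst_add[of g "f - h" h] by simp

text \<open>
  Used at two levels: for a polynomial it is the expansion into terms, for an exponent vector the
  expansion into multiples of unit vectors.
\<close>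

lemma sum_of_terms:
  "f = (\<Sum>m\<in>Poly_Mapping.keys f. Poly_Mapping.single m (Poly_Mapping.lookup f m))"
proof (rule poly_mapping_eqI)
  fix k
  have "Poly_Mapping.lookup f k =
      (\<Sum>m\<in>Poly_Mapping.keys f. if m = k then Poly_Mapping.lookup f m else 0)"
    by (simp add: in_keys_iff)
  then show "Poly_Mapping.lookup f k = Poly_Mapping.lookup
      (\<Sum>m\<in>Poly_Mapping.keys f. Poly_Mapping.single m (Poly_Mapping.lookup f m)) k"
    by (simp only: lookup_sum lookup_single when_def)
qed

lemma poly_subst_mult:
  fixes f h :: "'v mpoly"
  shows "poly_subst g (f * h) = poly_subst g f * poly_subst g h"
proof -
  have single: "poly_subst g (Poly_Mapping.single m a * Poly_Mapping.single m' b) =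
      poly_subst g (Poly_Mapping.single m a) * poly_subst g (Poly_Mapping.single m' b)" for m m' a b
    unfolding mult_single poly_subst_single Const_mult monom_value_add
    by (simp only: mult.assoc mult.left_commute)
  define terms where
    "terms f m = Poly_Mapping.single m (Poly_Mapping.lookup f m)" for f :: "'v mpoly" and m
  have terms: "(\<Sum>m\<in>Poly_Mapping.keys f. terms f m) = f" for f
    unfolding terms_def by (rule sum_of_terms[symmetric])
  have "poly_subst g ((\<Sum>m\<in>Poly_Mapping.keys f. terms f m) * (\<Sum>m\<in>Poly_Mapping.keys h. terms h m)) =
    poly_subst g (\<Sum>m\<in>Poly_Mapping.keys f. terms f m) *
    poly_subst g (\<Sum>m\<in>Poly_Mapping.keys h. terms h m)"
    unfolding sum_product poly_subst_sum terms_def single ..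
  then show ?thesis unfolding terms .
qed

lemma poly_subst_power: "poly_subst g (f ^ n) = poly_subst g f ^ n"
  by (induction n) (simp_all add: poly_subst_mult)

lemma poly_subst_prod_list: "poly_subst g (\<Prod>x\<leftarrow>xs. f x) = (\<Prod>x\<leftarrow>xs. poly_subst g (f x))"
  by (induction xs) (simp_all add: poly_subst_mult)

lemma poly_subst_sum_list: "poly_subst g (\<Sum>x\<leftarrow>xs. f x) = (\<Sum>x\<leftarrow>xs. poly_subst g (f x))"
  by (induction xs) (simp_all add: poly_subst_add)

lemma poly_subst_prod: "poly_subst g (\<Prod>x\<in>A. f x) = (\<Prod>x\<in>A. poly_subst g (f x))"
  by (induction A rule: infinite_finite_induct) (simp_all add: poly_subst_mult)

lemma poly_subst_poly_subst:
  "poly_subst h (poly_subst g f) = poly_subst (\<lambda>v. poly_subst h (g v)) f"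
  by (subst (1 2) poly_subst_def)
    (simp add: poly_subst_sum poly_subst_mult poly_subst_prod poly_subst_power)

section \<open>Polynomials in a given set of variables\<close>

lemma vars_Const [simp]: "vars (Const a) = {}"
  by (simp add: vars_def Const_def)

lemma vars_0 [simp]: "vars 0 = {}"
  by (simp add: vars_def)

lemma vars_1 [simp]: "vars 1 = {}"
  by (simp add: vars_def)

lemma vars_Var [simp]: "vars (Var v) = {v}"
  by (simp add: vars_def Var_def)

lemma vars_uminus [simp]: "vars (- f) = vars f"
proof -
  have "Poly_Mapping.keys (- f) = Poly_Mapping.keys f"
    by (auto simp: in_keys_iff)
  then show ?thesis by (simp add: vars_def)
qed

lemma vars_add: "vars f \<subseteq> X \<Longrightarrow> vars h \<subseteq> X \<Longrightarrow> vars (f + h) \<subseteq> X"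
  unfolding vars_def using keys_add[of f h] by blast

lemma vars_diff: "vars f \<subseteq> X \<Longrightarrow> vars h \<subseteq> X \<Longrightarrow> vars (f - h) \<subseteq> X"
  using vars_add[of f X "- h"] by simp

lemma vars_mult:
  assumes "vars f \<subseteq> X" "vars h \<subseteq> X"
  shows "vars (f * h) \<subseteq> X"
  unfolding vars_def
proof (rule UN_least)
  fix m assume "m \<in> Poly_Mapping.keys (f * h)"
  then obtain a b where "m = a + b" "a \<in> Poly_Mapping.keys f" "b \<in> Poly_Mapping.keys h"
    using keys_mult[of f h] by blast
  then show "Poly_Mapping.keys m \<subseteq> X"
    using keys_add[of a b] assms unfolding vars_def by blast
qed

lemma carrier_poly_ring [simp]: "f \<in> carrier (poly_ring X) \<longleftrightarrow> vars f \<subseteq> X"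
  by (simp add: poly_ring_def)

lemma poly_ring_simps [simp]:
  "mult (poly_ring X) = (*)" "one (poly_ring X) = 1"
  "zero (poly_ring X) = 0" "add (poly_ring X) = (+)"
  by (simp_all add: poly_ring_def)

lemma poly_ring_cring: "cring (poly_ring X)"
proof (rule cringI)
  show "abelian_group (poly_ring X)"
  proof (rule abelian_groupI)
    fix f assume "f \<in> carrier (poly_ring X)"
    then show "\<exists>h\<in>carrier (poly_ring X). h \<oplus>\<^bsub>poly_ring X\<^esub> f = \<zero>\<^bsub>poly_ring X\<^esub>"
      by (intro bexI[of _ "- f"]) auto
  qed (simp_all add: add_ac vars_add)
  show "comm_monoid (poly_ring X)"
    by (rule comm_monoidI) (simp_all add: mult_ac vars_mult)
qed (simp add: distrib_right)

lemma vars_sum: "(\<And>x. x \<in> A \<Longrightarrow> vars (f x) \<subseteq> X) \<Longrightarrow> vars (\<Sum>x\<in>A. f x) \<subseteq> X"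
  by (induction A rule: infinite_finite_induct) (simp_all add: vars_add)

lemma vars_sum_list: "(\<And>x. x \<in> set xs \<Longrightarrow> vars (f x) \<subseteq> X) \<Longrightarrow> vars (\<Sum>x\<leftarrow>xs. f x) \<subseteq> X"
  by (induction xs) (simp_all add: vars_add)

lemma vars_prod: "(\<And>x. x \<in> A \<Longrightarrow> vars (f x) \<subseteq> X) \<Longrightarrow> vars (\<Prod>x\<in>A. f x) \<subseteq> X"
  by (induction A rule: infinite_finite_induct) (simp_all add: vars_mult)

lemma vars_prod_list: "(\<And>x. x \<in> set xs \<Longrightarrow> vars (f x) \<subseteq> X) \<Longrightarrow> vars (\<Prod>x\<leftarrow>xs. f x) \<subseteq> X"
  by (induction xs) (simp_all add: vars_mult)

lemma vars_power: "vars f \<subseteq> X \<Longrightarrow> vars (f ^ n) \<subseteq> X"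
  by (induction n) (simp_all add: vars_mult)

lemma vars_poly_subst:
  assumes "\<And>v. v \<in> vars f \<Longrightarrow> vars (g v) \<subseteq> X"
  shows "vars (poly_subst g f) \<subseteq> X"
  unfolding poly_subst_def
proof (rule vars_sum)
  fix m assume m: "m \<in> Poly_Mapping.keys f"
  have "vars (\<Prod>v\<in>Poly_Mapping.keys m. g v ^ Poly_Mapping.lookup m v) \<subseteq> X"
    using m assms unfolding vars_def[of f] by (intro vars_prod vars_power) blast
  then show "vars (Const (Poly_Mapping.lookup f m) *
      (\<Prod>v\<in>Poly_Mapping.keys m. g v ^ Poly_Mapping.lookup m v)) \<subseteq> X"
    by (intro vars_mult) simp_all
qed

lemma alg_hom_poly_subst:
  assumes "\<And>v. v \<in> X \<Longrightarrow> vars (g v) \<subseteq> Y"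
  shows "alg_hom X Y (poly_subst g)"
  unfolding alg_hom_def
proof (intro conjI ring_hom_memI allI)
  fix f assume "f \<in> carrier (poly_ring X)"
  then show "poly_subst g f \<in> carrier (poly_ring Y)"
    using assms vars_poly_subst[of f g Y] by auto
qed (simp_all add: poly_subst_add poly_subst_mult)

lemma poly_ring_kernel_iff:
  "f \<in> a_kernel (poly_ring X) (poly_ring Y) \<psi> \<longleftrightarrow> vars f \<subseteq> X \<and> \<psi> f = 0"
  unfolding a_kernel_def' by (simp only: mem_Collect_eq carrier_poly_ring poly_ring_simps)

text \<open>
  Substituting each variable for itself writes a polynomial as a sum of products of constants and
  of variables that occur in it, so the variables may be restricted to \<open>X\<close> throughout.
\<close>

lemma mpoly_induct [consumes 1, case_names Const Var add mult]:
  fixes f :: "'v mpoly"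
  assumes vars: "vars f \<subseteq> X"
    and Const: "\<And>a. P (Const a)" and Var: "\<And>v. v \<in> X \<Longrightarrow> P (Var v)"
    and add: "\<And>f h. vars f \<subseteq> X \<Longrightarrow> vars h \<subseteq> X \<Longrightarrow> P f \<Longrightarrow> P h \<Longrightarrow> P (f + h)"
    and mult: "\<And>f h. vars f \<subseteq> X \<Longrightarrow> vars h \<subseteq> X \<Longrightarrow> P f \<Longrightarrow> P h \<Longrightarrow> P (f * h)"
  shows "P f"
proof -
  define Q where "Q f \<longleftrightarrow> vars f \<subseteq> X \<and> P f" for f
  have Q_Const: "Q (Const a)" for a using Const by (simp add: Q_def)
  have Q_Var: "Q (Var v)" if "v \<in> X" for v using Var that by (simp add: Q_def)
  have Q_0: "Q 0" and Q_1: "Q 1" using Q_Const[of 0] Q_Const[of 1] by simp_all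
  have Q_add: "Q (f + h)" and Q_mult: "Q (f * h)" if "Q f" "Q h" for f h
    using that add mult vars_add[of f X h] vars_mult[of f X h] by (auto simp: Q_def)
  have Q_sum: "Q (\<Sum>x\<in>A. h x)" if "\<And>x. x \<in> A \<Longrightarrow> Q (h x)" for A :: "('v \<Rightarrow>\<^sub>0 nat) set" and h
    using that by (induction A rule: infinite_finite_induct) (auto intro: Q_0 Q_add)
  have Q_prod: "Q (\<Prod>x\<in>A. h x)" if "\<And>x. x \<in> A \<Longrightarrow> Q (h x)" for A :: "'v set" and h
    using that by (induction A rule: infinite_finite_induct) (auto intro: Q_1 Q_mult)
  have Q_power: "Q (h ^ n)" if "Q h" for h n
    using that by (induction n) (auto intro: Q_1 Q_mult)
  have "Q (poly_subst Var f)"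
    unfolding poly_subst_def using vars
    by (intro Q_sum Q_mult Q_Const Q_prod Q_power Q_Var) (auto simp: vars_def)
  moreover have "poly_subst Var f = f"
  proof -
    have power: "Var v ^ n = (Poly_Mapping.single (Poly_Mapping.single v n) 1 :: 'v mpoly)" for v n
      by (induction n) (simp_all add: Var_def mult_single flip: single_add)
    have prod: "(\<Prod>v\<in>A. Var v ^ h v) =
        (Poly_Mapping.single (\<Sum>v\<in>A. Poly_Mapping.single v (h v)) 1 :: 'v mpoly)"
      for A and h :: "'v \<Rightarrow> nat"
      unfolding power by (induction A rule: infinite_finite_induct) (simp_all add: mult_single)
    have sum_keys: "(\<Sum>v\<in>Poly_Mapping.keys m. Poly_Mapping.single v (Poly_Mapping.lookup m v)) = m"
      for m :: "'v \<Rightarrow>\<^sub>0 nat"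
      by (rule sum_of_terms[symmetric])
    have "poly_subst Var f =
        (\<Sum>m\<in>Poly_Mapping.keys f. Poly_Mapping.single m (Poly_Mapping.lookup f m))"
      unfolding poly_subst_def prod sum_keys by (simp add: Const_def mult_single)
    also have "\<dots> = f" by (rule sum_of_terms[symmetric])
    finally show ?thesis .
  qed
  ultimately show ?thesis by (simp add: Q_def)
qed

section \<open>Paths of a staged tree\<close>

text \<open>
  Structural induction that keeps track of membership in \<open>subtrees T\<close>: the staging conditions are
  stated for the subtrees of one fixed tree, since a stage may have vertices in several branches.
\<close>

lemma subtrees_induct_down [consumes 1, case_names Leaf Inner]:
  assumes "t \<in> subtrees T"
    and "P Leaf"
    and "\<And>c es. Inner c es \<in> subtrees T \<Longrightarrow>
      (\<And>l u. (l, u) \<in> set es \<Longrightarrow> u \<in> subtrees T \<and> P u) \<Longrightarrow> P (Inner c es)"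
  shows "P t"
  using assms(1)
proof (induction t rule: tree.induct)
  case Leaf
  show ?case by (rule assms(2))
next
  case (Inner c es)
  show ?case
  proof (rule assms(3)[OF Inner.prems])
    fix l u assume lu: "(l, u) \<in> set es"
    have "u \<in> subtrees T" using subtrees.child[OF Inner.prems lu] .
    then show "u \<in> subtrees T \<and> P u" using Inner.IH[OF lu, of u] by simp
  qed
qed

lemma set_paths_Inner: "set (paths (Inner c es)) = (\<Union>(l, u)\<in>set es. (#) l ` set (paths u))"
  by auto

lemma sum_list_paths_Inner:
  fixes h :: "'l list \<Rightarrow> 'a::comm_monoid_add"
  shows "(\<Sum>\<pi>\<leftarrow>paths (Inner c es). h \<pi>) = (\<Sum>(l, u)\<leftarrow>es. \<Sum>\<mu>\<leftarrow>paths u. h (l # \<mu>))"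
proof -
  have "(\<Sum>\<pi>\<leftarrow>concat (map (\<lambda>(l, u). map ((#) l) (paths u)) es). h \<pi>) =
      (\<Sum>(l, u)\<leftarrow>es. \<Sum>\<mu>\<leftarrow>paths u. h (l # \<mu>))"
    by (induction es) (auto simp: o_def)
  then show ?thesis by simp
qed

locale staged =
  fixes T :: "('c, 'l) tree"
  assumes staged: "staged_tree T"
begin

lemma inner_nonempty:
  assumes "Inner c es \<in> subtrees T"
  shows "es \<noteq> []"
proof -
  have "length es \<ge> 2" using assms staged unfolding staged_tree_def by blast
  then show ?thesis by auto
qed

lemma labels_distinct: "Inner c es \<in> subtrees T \<Longrightarrow> distinct (map fst es)"
  using staged unfolding staged_tree_def by blast

lemma shared_label_same_stage:
  assumes "Inner c es \<in> subtrees T" "Inner c' es' \<in> subtrees T"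
    and "l \<in> fst ` set es" "l \<in> fst ` set es'"
  shows "c = c'" "map fst es = map fst es'"
proof -
  show "c = c'" using assms staged unfolding staged_tree_def by blast
  then show "map fst es = map fst es'" using assms staged unfolding staged_tree_def by blast
qed

lemma paths_nonempty: "t \<in> subtrees T \<Longrightarrow> paths t \<noteq> []"
proof (induction rule: subtrees_induct_down)
  case (Inner c es)
  obtain l u es' where "es = (l, u) # es'" using inner_nonempty[OF Inner(1)] by (cases es) auto
  then show ?case using Inner(2)[of l u] by auto
qed simp

lemma paths_distinct: "t \<in> subtrees T \<Longrightarrow> distinct (paths t)"
proof (induction rule: subtrees_induct_down)
  case (Inner c es)
  have "distinct (map fst es)" by (rule labels_distinct[OF Inner(1)])
  moreover have "\<forall>(l, u)\<in>set es. distinct (paths u)" using Inner(2) by auto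
  ultimately have "distinct (concat (map (\<lambda>(l, u). map ((#) l) (paths u)) es))"
    by (induction es) (auto simp: distinct_map image_iff)
  then show ?case by simp
qed simp

lemma paths_short_child:
  assumes "(l, u) \<in> set es" "\<forall>\<pi>\<in>set (paths (Inner c es)). length \<pi> \<le> D"
  shows "\<forall>\<mu>\<in>set (paths u). length \<mu> \<le> D - 1"
proof
  fix \<mu> assume "\<mu> \<in> set (paths u)"
  then have "l # \<mu> \<in> set (paths (Inner c es))" using assms(1) unfolding set_paths_Inner by force
  then show "length \<mu> \<le> D - 1" using assms(2) by force
qed

lemma inner_depth_pos:
  assumes "Inner c es \<in> subtrees T" "\<forall>\<pi>\<in>set (paths (Inner c es)). length \<pi> \<le> D"
  shows "D > 0"
proof -
  obtain \<pi> where "\<pi> \<in> set (paths (Inner c es))"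
    using paths_nonempty[OF assms(1)] by (meson list.set_sel(1))
  moreover from this have "\<pi> \<noteq> []" unfolding set_paths_Inner by auto
  ultimately show ?thesis using assms(2) by fastforce
qed

end

section \<open>Linear forms with monomial values\<close>

text \<open>
  The homogenised value of a path in degree \<open>D\<close> when the label \<open>l\<close> takes the value \<open>f l\<close>. The degree is
  a parameter because passing to a child subtree lowers it by one.
\<close>

definition path_value :: "'b::comm_ring_1 \<Rightarrow> ('l \<Rightarrow> 'b) \<Rightarrow> nat \<Rightarrow> 'l list \<Rightarrow> 'b" where
  "path_value z f D \<pi> = z ^ (D - length \<pi>) * (\<Prod>l\<leftarrow>\<pi>. f l)"

lemma path_value_Nil [simp]: "path_value z f D [] = z ^ D"
  by (simp add: path_value_def)

lemma path_value_Cons: "path_value z f D (l # \<mu>) = f l * path_value z f (D - 1) \<mu>"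
  by (simp add: path_value_def mult_ac)

text \<open>
  The setting of the induction over the tree. The additive map \<open>F\<close> sends the forms that stand for the
  root-to-leaf paths to ring elements. The label values \<open>s\<close> satisfy the sum condition at every inner
  vertex; the values \<open>\<tau>\<close>, used in the toric monomials, agree with them except at first labels. The
  subtree-inclusion property enters as the last assumption.
\<close>

locale sip_evaluation = staged T + vector_space scale
  for T :: "('c, 'l) tree" and scale :: "'k::field \<Rightarrow> 'v::ab_group_add \<Rightarrow> 'v" +
  fixes F :: "'v \<Rightarrow> 'b::comm_ring_1" and z :: 'b and s \<tau> :: "'l \<Rightarrow> 'b"
  assumes F_add: "F (x + y) = F x + F y"
    and sum_s: "Inner c es \<in> subtrees T \<Longrightarrow> (\<Sum>(l, u)\<leftarrow>es. s l) = z"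
    and \<tau>_first: "Inner c ((l, u) # es) \<in> subtrees T \<Longrightarrow> \<tau> l = z"
    and \<tau>_other: "Inner c (e # es) \<in> subtrees T \<Longrightarrow> (l, u) \<in> set es \<Longrightarrow> \<tau> l = s l"
    and SIP_first: "Inner c ((l\<^sub>1, t\<^sub>1) # es) \<in> subtrees T \<Longrightarrow> (l, u) \<in> set es \<Longrightarrow>
      contains_at_root u t\<^sub>1"
begin

lemma F_0: "F 0 = 0"
  using F_add[of 0 0] by simp

lemma F_sum_list: "F (\<Sum>x\<leftarrow>xs. f x) = (\<Sum>x\<leftarrow>xs. F (f x))"
  by (induction xs) (simp_all add: F_0 F_add)

lemma span_sum_list: "(\<And>x. x \<in> set xs \<Longrightarrow> f x \<in> span S) \<Longrightarrow> (\<Sum>x\<leftarrow>xs. f x) \<in> span S"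
  by (induction xs) (auto intro: span_zero span_add)

text \<open>
  From the leaves upwards, the branches at a vertex all contribute the same power of \<open>z\<close>, times their
  labels, and the labels sum to one more factor \<open>z\<close>.
\<close>

lemma sum_path_value:
  assumes "t \<in> subtrees T" "\<forall>\<pi>\<in>set (paths t). length \<pi> \<le> D"
  shows "(\<Sum>\<pi>\<leftarrow>paths t. path_value z s D \<pi>) = z ^ D"
  using assms
proof (induction arbitrary: D rule: subtrees_induct_down)
  case Leaf
  show ?case by simp
next
  case (Inner c es)
  have "(\<Sum>\<pi>\<leftarrow>paths (Inner c es). path_value z s D \<pi>) =
      (\<Sum>(l, u)\<leftarrow>es. \<Sum>\<mu>\<leftarrow>paths u. s l * path_value z s (D - 1) \<mu>)"
    unfolding sum_list_paths_Inner path_value_Cons ..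
  also have "\<dots> = (\<Sum>(l, u)\<leftarrow>es. s l * z ^ (D - 1))"
  proof (rule arg_cong[where f = sum_list], rule map_cong[OF refl], clarify)
    fix l u assume lu: "(l, u) \<in> set es"
    show "(\<Sum>\<mu>\<leftarrow>paths u. s l * path_value z s (D - 1) \<mu>) = s l * z ^ (D - 1)"
      using Inner(2)[OF lu] paths_short_child[OF lu Inner(3)] by (simp add: sum_list_const_mult)
  qed
  also have "\<dots> = (\<Sum>(l, u)\<leftarrow>es. s l) * z ^ (D - 1)"
    by (simp add: case_prod_unfold sum_list_mult_const)
  also have "\<dots> = z ^ D"
    using sum_s[OF Inner(1)] inner_depth_pos[OF Inner(1,3)]
    by (simp flip: power_Suc)
  finally show ?case .
qed

text \<open>
  The factor \<open>g\<close> collects the values of the edges above the subtree \<open>t\<close>.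
\<close>

definition evaluates :: "('l \<Rightarrow> 'b) \<Rightarrow> ('c, 'l) tree \<Rightarrow> nat \<Rightarrow> 'b \<Rightarrow> ('l list \<Rightarrow> 'v) \<Rightarrow> bool" where
  "evaluates f t D g p \<longleftrightarrow> (\<forall>\<pi>\<in>set (paths t). F (p \<pi>) = g * path_value z f D \<pi>)"

lemma evaluatesD: "evaluates f t D g p \<Longrightarrow> \<pi> \<in> set (paths t) \<Longrightarrow> F (p \<pi>) = g * path_value z f D \<pi>"
  unfolding evaluates_def by blast

lemma evaluates_child:
  assumes "evaluates f (Inner c es) D g p" "(l, u) \<in> set es"
  shows "evaluates f u (D - 1) (g * f l) (\<lambda>\<mu>. p (l # \<mu>))"
  unfolding evaluates_def
proof
  fix \<mu> assume "\<mu> \<in> set (paths u)"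
  then have "l # \<mu> \<in> set (paths (Inner c es))" using assms(2) unfolding set_paths_Inner by force
  from evaluatesD[OF assms(1) this]
  show "F (p (l # \<mu>)) = g * f l * path_value z f (D - 1) \<mu>"
    unfolding path_value_Cons by (simp add: mult.assoc)
qed

text \<open>
  If \<open>t\<close> is a subtree of \<open>t'\<close> with the same root, then a leaf of \<open>t\<close> is a vertex of \<open>t'\<close>, and by
  \<open>sum_path_value\<close> the forms of all paths of \<open>t'\<close> through that vertex add up to a form with the value that
  the leaf has in \<open>t\<close>. The condition on sums records that every path of \<open>t'\<close> is used exactly once.
\<close>

definition liftable :: "('c, 'l) tree \<Rightarrow> ('c, 'l) tree \<Rightarrow> bool" where
  "liftable t' t \<longleftrightarrow>
     (\<forall>D g p. (\<forall>\<pi>\<in>set (paths t'). length \<pi> \<le> D) \<longrightarrow> evaluates s t' D g p \<longrightarrow>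
       (\<exists>v. evaluates s t D g v \<and> v ` set (paths t) \<subseteq> span (p ` set (paths t')) \<and>
         (\<Sum>\<pi>\<leftarrow>paths t. v \<pi>) = (\<Sum>\<pi>\<leftarrow>paths t'. p \<pi>)))"

lemma liftableI:
  assumes "\<And>D g p. \<forall>\<pi>\<in>set (paths t'). length \<pi> \<le> D \<Longrightarrow> evaluates s t' D g p \<Longrightarrow>
    \<exists>v. evaluates s t D g v \<and> v ` set (paths t) \<subseteq> span (p ` set (paths t')) \<and>
      (\<Sum>\<pi>\<leftarrow>paths t. v \<pi>) = (\<Sum>\<pi>\<leftarrow>paths t'. p \<pi>)"
  shows "liftable t' t"
  using assms unfolding liftable_def by blast

lemma liftableD:
  assumes "liftable t' t" "\<forall>\<pi>\<in>set (paths t'). length \<pi> \<le> D" "evaluates s t' D g p"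
  obtains v where "evaluates s t D g v" "v ` set (paths t) \<subseteq> span (p ` set (paths t'))"
    "(\<Sum>\<pi>\<leftarrow>paths t. v \<pi>) = (\<Sum>\<pi>\<leftarrow>paths t'. p \<pi>)"
  using assms unfolding liftable_def by blast

text \<open>
  A common inner vertex of the two trees shares a label, so it has the same stage and hence the same
  outgoing labels in both. The smaller tree therefore never drops a branch at one of its inner
  vertices, and its leaves cut across all paths of the larger one.
\<close>

lemma contains_at_root_liftable:
  assumes "contains_at_root t' t" "t' \<in> subtrees T" "t \<in> subtrees T"
  shows "liftable t' t"
  using assms
proof (induction)
  case (leaf t')
  show ?case
  proof (rule liftableI)
    fix D g p
    assume short: "\<forall>\<pi>\<in>set (paths t'). length \<pi> \<le> D" and val: "evaluates s t' D g p"
    have "F (\<Sum>\<pi>\<leftarrow>paths t'. p \<pi>) = (\<Sum>\<pi>\<leftarrow>paths t'. g * path_value z s D \<pi>)"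
      unfolding F_sum_list using evaluatesD[OF val] by (intro arg_cong[where f = sum_list] map_cong) auto
    also have "\<dots> = g * z ^ D"
      using sum_path_value[OF leaf(1) short] by (simp add: sum_list_const_mult)
    finally have "F (\<Sum>\<pi>\<leftarrow>paths t'. p \<pi>) = g * z ^ D" .
    moreover have "(\<Sum>\<pi>\<leftarrow>paths t'. p \<pi>) \<in> span (p ` set (paths t'))"
      by (rule span_sum_list) (auto intro: span_base)
    ultimately show "\<exists>v. evaluates s Leaf D g v \<and>
        v ` set (paths Leaf) \<subseteq> span (p ` set (paths t')) \<and>
        (\<Sum>\<pi>\<leftarrow>paths Leaf. v \<pi>) = (\<Sum>\<pi>\<leftarrow>paths t'. p \<pi>)"
      by (intro exI[of _ "\<lambda>_. \<Sum>\<pi>\<leftarrow>paths t'. p \<pi>"]) (simp add: evaluates_def)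
  qed
next
  case (inner es es' c' c)
  note sub' = inner.prems(1) and sub = inner.prems(2)
  \<comment> \<open>One common label is enough to make the two label lists equal.\<close>
  obtain l s\<^sub>0 where l: "(l, s\<^sub>0) \<in> set es" using inner_nonempty[OF sub] by (cases es) auto
  then have "l \<in> fst ` set es" "l \<in> fst ` set es'" using inner.IH[OF l] by force+
  then have labels_eq: "map fst es' = map fst es"
    using shared_label_same_stage(2)[OF sub' sub] by blast
  have liftable: "liftable t1 s1" if ls: "(l, s1) \<in> set es" and lt: "(l, t1) \<in> set es'" for l s1 t1
  proof -
    obtain t2 where t2: "(l, t2) \<in> set es'"
      and IH: "t2 \<in> subtrees T \<Longrightarrow> s1 \<in> subtrees T \<Longrightarrow> liftable t2 s1"
      using inner.IH[OF ls] by blast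
    have "t2 = t1" using lt t2 labels_distinct[OF sub'] by (metis eq_key_imp_eq_value)
    then show ?thesis using IH subtrees.child[OF sub' lt] subtrees.child[OF sub ls] by blast
  qed
  show ?case
  proof (rule liftableI)
    fix D g p
    assume short: "\<forall>\<pi>\<in>set (paths (Inner c' es')). length \<pi> \<le> D"
      and val: "evaluates s (Inner c' es') D g p"
    have "\<exists>v. evaluates s s1 (D - 1) (g * s l) v \<and>
        v ` set (paths s1) \<subseteq> span ((\<lambda>\<mu>. p (l # \<mu>)) ` set (paths t1)) \<and>
        (\<Sum>\<mu>\<leftarrow>paths s1. v \<mu>) = (\<Sum>\<mu>\<leftarrow>paths t1. p (l # \<mu>))"
      if "(l, s1) \<in> set es" and lt: "(l, t1) \<in> set es'" for l s1 t1
      using liftableD[OF liftable[OF that] paths_short_child[OF lt short] evaluates_child[OF val lt]]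
      by metis
    then obtain V where V: "\<And>l s1 t1. (l, s1) \<in> set es \<Longrightarrow> (l, t1) \<in> set es' \<Longrightarrow>
        evaluates s s1 (D - 1) (g * s l) (V l s1 t1) \<and>
        V l s1 t1 ` set (paths s1) \<subseteq> span ((\<lambda>\<mu>. p (l # \<mu>)) ` set (paths t1)) \<and>
        (\<Sum>\<mu>\<leftarrow>paths s1. V l s1 t1 \<mu>) = (\<Sum>\<mu>\<leftarrow>paths t1. p (l # \<mu>))"
      by metis
    define child where "child fs l = the (map_of fs l)" for fs :: "('l \<times> ('c, 'l) tree) list" and l
    have child: "child es l = u" if "(l, u) \<in> set es" for l u
      using that labels_distinct[OF sub] by (simp add: child_def)
    have child': "child es' l = u" if "(l, u) \<in> set es'" for l u
      using that labels_distinct[OF sub'] by (simp add: child_def)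
    define v where "v \<pi> = (let l = hd \<pi> in V l (child es l) (child es' l) (tl \<pi>))" for \<pi>
    have ex': "\<exists>t1. (l, t1) \<in> set es'" if "(l, s1) \<in> set es" for l s1
    proof -
      have "l \<in> set (map fst es')" using that unfolding labels_eq by force
      then show ?thesis by auto
    qed
    have v_Cons: "v (l # \<mu>) = V l s1 t1 \<mu>" if "(l, s1) \<in> set es" "(l, t1) \<in> set es'" for l s1 t1 \<mu>
      using child child' that by (simp add: v_def)
    show "\<exists>v. evaluates s (Inner c es) D g v \<and>
        v ` set (paths (Inner c es)) \<subseteq> span (p ` set (paths (Inner c' es'))) \<and>
        (\<Sum>\<pi>\<leftarrow>paths (Inner c es). v \<pi>) = (\<Sum>\<pi>\<leftarrow>paths (Inner c' es'). p \<pi>)"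
    proof (intro exI[of _ v] conjI)
      show "evaluates s (Inner c es) D g v" unfolding evaluates_def
      proof
        fix \<pi> assume "\<pi> \<in> set (paths (Inner c es))"
        then obtain l s1 \<mu> where 1: "(l, s1) \<in> set es" "\<mu> \<in> set (paths s1)" "\<pi> = l # \<mu>"
          unfolding set_paths_Inner by auto
        obtain t1 where 2: "(l, t1) \<in> set es'" using ex'[OF 1(1)] ..
        show "F (v \<pi>) = g * path_value z s D \<pi>"
          using evaluatesD[OF _ 1(2)] V[OF 1(1) 2]
          unfolding 1(3) v_Cons[OF 1(1) 2] path_value_Cons by (metis mult.assoc)
      qed
      show "v ` set (paths (Inner c es)) \<subseteq> span (p ` set (paths (Inner c' es')))"
      proof
        fix x assume "x \<in> v ` set (paths (Inner c es))"
        then obtain l s1 \<mu> where 1: "(l, s1) \<in> set es" "\<mu> \<in> set (paths s1)" "x = v (l # \<mu>)"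
          unfolding set_paths_Inner by auto
        obtain t1 where 2: "(l, t1) \<in> set es'" using ex'[OF 1(1)] ..
        have "x \<in> span ((\<lambda>\<mu>. p (l # \<mu>)) ` set (paths t1))"
          using V[OF 1(1) 2] 1(2) unfolding 1(3) v_Cons[OF 1(1) 2] by blast
        also have "\<dots> \<subseteq> span (p ` set (paths (Inner c' es')))"
          using 2 unfolding set_paths_Inner by (intro span_mono) force
        finally show "x \<in> span (p ` set (paths (Inner c' es')))" .
      qed
      let ?f = "\<lambda>l. \<Sum>\<mu>\<leftarrow>paths (child es' l). p (l # \<mu>)"
      have "(\<Sum>\<pi>\<leftarrow>paths (Inner c es). v \<pi>) = (\<Sum>l\<leftarrow>map fst es. ?f l)"
        unfolding sum_list_paths_Inner map_map
      proof (rule arg_cong[where f = sum_list], rule map_cong[OF refl], clarify)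
        fix l s1 assume 1: "(l, s1) \<in> set es"
        obtain t1 where 2: "(l, t1) \<in> set es'" using ex'[OF 1] ..
        show "(\<Sum>\<mu>\<leftarrow>paths s1. v (l # \<mu>)) = (?f \<circ> fst) (l, s1)"
          using V[OF 1 2] v_Cons[OF 1 2] child'[OF 2] by simp
      qed
      also have "\<dots> = (\<Sum>l\<leftarrow>map fst es'. ?f l)" unfolding labels_eq ..
      also have "\<dots> = (\<Sum>\<pi>\<leftarrow>paths (Inner c' es'). p \<pi>)"
        unfolding sum_list_paths_Inner map_map
        by (rule arg_cong[where f = sum_list], rule map_cong[OF refl], clarify) (simp add: child')
      finally show "(\<Sum>\<pi>\<leftarrow>paths (Inner c es). v \<pi>) = (\<Sum>\<pi>\<leftarrow>paths (Inner c' es'). p \<pi>)" .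
    qed
  qed
qed

text \<open>
  The induction behind the theorem. Below an edge that is not the first one, the forms for the child
  subtree can be kept, since \<open>s\<close> and \<open>\<tau>\<close> agree on its label. Below the first edge, with label \<open>l\<^sub>1\<close> and
  subtree \<open>t\<^sub>1\<close>, the forms for \<open>t\<^sub>1\<close> have values \<open>s l\<^sub>1 * m\<close> with \<open>m\<close> the monomial of the path in \<open>t\<^sub>1\<close>, while
  the value wanted is \<open>z * m\<close>. The difference is the sum of \<open>s l * m\<close> over the other edges. Every
  sibling subtree contains \<open>t\<^sub>1\<close> at its root, so its forms lift to forms indexed by the paths of \<open>t\<^sub>1\<close>,
  and the induction hypothesis for \<open>t\<^sub>1\<close>, applied to these lifted forms, yields the summand \<open>s l * m\<close>.
  Each correction lies in the span of the forms of one later branch, so the change is block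
  triangular and preserves the span.
\<close>

lemma monomial_forms:
  assumes "t \<in> subtrees T"
    and "\<forall>\<pi>\<in>set (paths t). length \<pi> \<le> D"
    and "evaluates s t D g p"
  shows "\<exists>ell. evaluates \<tau> t D g ell \<and>
    span (ell ` set (paths t)) = span (p ` set (paths t)) \<and>
    ell (hd (paths t)) = (\<Sum>\<pi>\<leftarrow>paths t. p \<pi>)"
  using assms
proof (induction arbitrary: D g p rule: subtrees_induct_down)
  case Leaf
  then show ?case by (intro exI[of _ p]) (simp add: evaluates_def)
next
  case (Inner c es)
  note sub = Inner(1) and short = Inner(3) and val = Inner(4)
  obtain l\<^sub>1 t\<^sub>1 rest where es: "es = (l\<^sub>1, t\<^sub>1) # rest"
    using inner_nonempty[OF sub] by (cases es) auto
  have first: "(l\<^sub>1, t\<^sub>1) \<in> set es" by (simp add: es)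
  have rest: "x \<in> set rest \<Longrightarrow> x \<in> set es" for x by (simp add: es)
  have child: "u \<in> subtrees T" if "(l, u) \<in> set es" for l u using Inner(2)[OF that] by blast
  have short': "\<forall>\<mu>\<in>set (paths u). length \<mu> \<le> D - 1" if "(l, u) \<in> set es" for l u
    by (rule paths_short_child[OF that short])
  have val': "evaluates s u (D - 1) (g * s l) (\<lambda>\<mu>. p (l # \<mu>))" if "(l, u) \<in> set es" for l u
    by (rule evaluates_child[OF val that])
  have IH: "\<exists>ell. evaluates \<tau> u D g ell \<and>
      span (ell ` set (paths u)) = span (p ` set (paths u)) \<and>
      ell (hd (paths u)) = (\<Sum>\<pi>\<leftarrow>paths u. p \<pi>)"
    if "(l, u) \<in> set es" "\<forall>\<pi>\<in>set (paths u). length \<pi> \<le> D" "evaluates s u D g p" for l u D g p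
    using Inner(2)[OF that(1)] that(2,3) by blast
  let ?S = "\<lambda>l u. span ((\<lambda>\<mu>. p (l # \<mu>)) ` set (paths u))"
  have "\<exists>e. evaluates \<tau> u (D - 1) (g * s l) e \<and>
      span (e ` set (paths u)) = ?S l u \<and> e (hd (paths u)) = (\<Sum>\<mu>\<leftarrow>paths u. p (l # \<mu>))"
    if "(l, u) \<in> set es" for l u
    by (rule IH[OF that short'[OF that] val'[OF that]])
  then obtain E where E: "\<And>l u. (l, u) \<in> set es \<Longrightarrow>
      evaluates \<tau> u (D - 1) (g * s l) (E l u) \<and>
      span (E l u ` set (paths u)) = ?S l u \<and> E l u (hd (paths u)) = (\<Sum>\<mu>\<leftarrow>paths u. p (l # \<mu>))"
    by metis
  \<comment> \<open>The correction coming from the sibling below the edge \<open>l\<close>.\<close>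
  have "\<exists>e. evaluates \<tau> t\<^sub>1 (D - 1) (g * s l) e \<and>
      e ` set (paths t\<^sub>1) \<subseteq> ?S l u \<and> e (hd (paths t\<^sub>1)) = (\<Sum>\<mu>\<leftarrow>paths u. p (l # \<mu>))"
    if "(l, u) \<in> set rest" for l u
  proof -
    have lu: "(l, u) \<in> set es" using that by (rule rest)
    have "contains_at_root u t\<^sub>1" using SIP_first[OF sub[unfolded es] that] .
    then obtain v where v: "evaluates s t\<^sub>1 (D - 1) (g * s l) v"
        "v ` set (paths t\<^sub>1) \<subseteq> ?S l u"
        "(\<Sum>\<mu>\<leftarrow>paths t\<^sub>1. v \<mu>) = (\<Sum>\<mu>\<leftarrow>paths u. p (l # \<mu>))"
      using liftableD[OF contains_at_root_liftable[OF _ child[OF lu] child[OF first]]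
        short'[OF lu] val'[OF lu]] by blast
    obtain e where e: "evaluates \<tau> t\<^sub>1 (D - 1) (g * s l) e"
        "span (e ` set (paths t\<^sub>1)) = span (v ` set (paths t\<^sub>1))"
        "e (hd (paths t\<^sub>1)) = (\<Sum>\<mu>\<leftarrow>paths t\<^sub>1. v \<mu>)"
      using IH[OF first short'[OF first] v(1)] by blast
    have "e ` set (paths t\<^sub>1) \<subseteq> span (v ` set (paths t\<^sub>1))"
      using e(2) span_superset by blast
    also have "\<dots> \<subseteq> ?S l u" by (rule span_minimal[OF v(2) subspace_span])
    finally show ?thesis using e v(3) by metis
  qed
  then obtain E' where E': "\<And>l u. (l, u) \<in> set rest \<Longrightarrow>
      evaluates \<tau> t\<^sub>1 (D - 1) (g * s l) (E' l u) \<and>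
      E' l u ` set (paths t\<^sub>1) \<subseteq> ?S l u \<and> E' l u (hd (paths t\<^sub>1)) = (\<Sum>\<mu>\<leftarrow>paths u. p (l # \<mu>))"
    by metis
  define ell where "ell \<pi> =
    (if hd \<pi> = l\<^sub>1 then E l\<^sub>1 t\<^sub>1 (tl \<pi>) + (\<Sum>(l, u)\<leftarrow>rest. E' l u (tl \<pi>))
     else E (hd \<pi>) (the (map_of es (hd \<pi>))) (tl \<pi>))" for \<pi>
  have ell_first: "ell (l\<^sub>1 # \<mu>) = E l\<^sub>1 t\<^sub>1 \<mu> + (\<Sum>(l, u)\<leftarrow>rest. E' l u \<mu>)" for \<mu>
    by (simp add: ell_def)
  have ell_rest: "ell (l # \<mu>) = E l u \<mu>" if "(l, u) \<in> set rest" for l u \<mu>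
  proof -
    have "l \<noteq> l\<^sub>1" using labels_distinct[OF sub] that unfolding es by force
    then show ?thesis using labels_distinct[OF sub] rest[OF that] by (simp add: ell_def)
  qed
  let ?P = "set (paths (Inner c es))"
  have P_cases [consumes 1, case_names 1 2]: thesis if "\<pi> \<in> ?P"
    "\<And>\<mu>. \<pi> = l\<^sub>1 # \<mu> \<Longrightarrow> \<mu> \<in> set (paths t\<^sub>1) \<Longrightarrow> thesis"
    "\<And>l u \<mu>. \<pi> = l # \<mu> \<Longrightarrow> (l, u) \<in> set rest \<Longrightarrow> \<mu> \<in> set (paths u) \<Longrightarrow> thesis" for \<pi> thesis
    using that unfolding set_paths_Inner es by auto
  have P_I: "l # \<mu> \<in> ?P" if "(l, u) \<in> set es" "\<mu> \<in> set (paths u)" for l u \<mu>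
    using that unfolding set_paths_Inner by force
  have S_p: "?S l u \<subseteq> span (p ` ?P)" if "(l, u) \<in> set es" for l u
    using P_I[OF that] by (intro span_mono) blast
  have S_ell: "?S l u \<subseteq> span (ell ` ?P)" if "(l, u) \<in> set rest" for l u
  proof -
    have "?S l u = span (E l u ` set (paths u))" using E[OF rest[OF that]] by simp
    also have "\<dots> \<subseteq> span (ell ` ?P)"
    proof (rule span_mono, clarify)
      fix \<mu> assume "\<mu> \<in> set (paths u)"
      from P_I[OF rest[OF that] this] show "E l u \<mu> \<in> ell ` ?P"
        unfolding ell_rest[OF that, symmetric] by (rule imageI)
    qed
    finally show ?thesis .
  qed
  have E_S: "E l u \<mu> \<in> ?S l u" if "(l, u) \<in> set es" "\<mu> \<in> set (paths u)" for l u \<mu>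
    using E[OF that(1)] that(2) by (metis imageI span_base)
  have E'_S: "E' l u \<mu> \<in> ?S l u" if "(l, u) \<in> set rest" "\<mu> \<in> set (paths t\<^sub>1)" for l u \<mu>
    using E'[OF that(1)] that(2) by blast
  have E_val: "F (E l u \<mu>) = g * s l * path_value z \<tau> (D - 1) \<mu>"
    if "(l, u) \<in> set es" "\<mu> \<in> set (paths u)" for l u \<mu>
    using evaluatesD[OF _ that(2)] E[OF that(1)] by blast
  have E'_val: "F (E' l u \<mu>) = g * s l * path_value z \<tau> (D - 1) \<mu>"
    if "(l, u) \<in> set rest" "\<mu> \<in> set (paths t\<^sub>1)" for l u \<mu>
    using evaluatesD[OF _ that(2)] E'[OF that(1)] by blast
  show ?case
  proof (intro exI[of _ ell] conjI)
    show "evaluates \<tau> (Inner c es) D g ell" unfolding evaluates_def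
    proof
      fix \<pi> assume "\<pi> \<in> ?P"
      then show "F (ell \<pi>) = g * path_value z \<tau> D \<pi>"
      proof (cases rule: P_cases)
        case (1 \<mu>)
        let ?m = "path_value z \<tau> (D - 1) \<mu>"
        have "F (ell \<pi>) = F (E l\<^sub>1 t\<^sub>1 \<mu>) + (\<Sum>(l, u)\<leftarrow>rest. F (E' l u \<mu>))"
          unfolding 1 ell_first F_add F_sum_list by (simp add: case_prod_unfold)
        also have "F (E l\<^sub>1 t\<^sub>1 \<mu>) = s l\<^sub>1 * (g * ?m)" using E_val[OF first 1(2)] by (simp add: mult_ac)
        also have "(\<Sum>(l, u)\<leftarrow>rest. F (E' l u \<mu>)) = (\<Sum>(l, u)\<leftarrow>rest. s l * (g * ?m))"
          using E'_val[OF _ 1(2)]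
          by (intro arg_cong[where f = sum_list] map_cong) (auto simp: mult_ac)
        \<comment> \<open>The corrections complete the value of the first label to the sum \<open>z\<close> of all labels at the
          vertex.\<close>
        also have "s l\<^sub>1 * (g * ?m) + (\<Sum>(l, u)\<leftarrow>rest. s l * (g * ?m)) =
            (\<Sum>(l, u)\<leftarrow>es. s l) * (g * ?m)"
          by (simp add: es case_prod_unfold sum_list_mult_const distrib_right)
        also have "\<dots> = g * path_value z \<tau> D \<pi>"
          using sum_s[OF sub] \<tau>_first[OF sub[unfolded es]] by (simp add: 1 path_value_Cons mult_ac)
        finally show ?thesis .
      next
        case (2 l u \<mu>)
        then show ?thesis
          using E_val[OF rest[OF 2(2)] 2(3)] \<tau>_other[OF sub[unfolded es] 2(2)]
            ell_rest[OF 2(2)]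
          by (simp add: path_value_Cons mult_ac)
      qed
    qed
  next
    show "span (ell ` ?P) = span (p ` ?P)"
    proof (rule antisym; rule span_minimal[OF _ subspace_span]; rule subsetI)
      fix x assume "x \<in> ell ` ?P"
      then obtain \<pi> where "\<pi> \<in> ?P" and x: "x = ell \<pi>" by blast
      from this(1) show "x \<in> span (p ` ?P)"
      proof (cases rule: P_cases)
        case (1 \<mu>)
        have "E l\<^sub>1 t\<^sub>1 \<mu> \<in> span (p ` ?P)" using E_S[OF first 1(2)] S_p[OF first] by blast
        moreover have "(\<Sum>(l, u)\<leftarrow>rest. E' l u \<mu>) \<in> span (p ` ?P)"
          using E'_S[OF _ 1(2)] S_p[OF rest] by (intro span_sum_list) (clarify, blast)
        ultimately show ?thesis unfolding x 1(1) ell_first by (rule span_add)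
      next
        case (2 l u \<mu>)
        have "x \<in> ?S l u"
          unfolding x 2(1) ell_rest[OF 2(2)] by (rule E_S[OF rest[OF 2(2)] 2(3)])
        then show ?thesis using S_p[OF rest[OF 2(2)]] by blast
      qed
    next
      fix x assume "x \<in> p ` ?P"
      then obtain \<pi> where "\<pi> \<in> ?P" and x: "x = p \<pi>" by blast
      from this(1) show "x \<in> span (ell ` ?P)"
      proof (cases rule: P_cases)
        case (1 \<mu>)
        have "x \<in> ?S l\<^sub>1 t\<^sub>1" unfolding x 1(1) using 1(2) by (intro span_base) blast
        also have "\<dots> = span (E l\<^sub>1 t\<^sub>1 ` set (paths t\<^sub>1))" using E[OF first] by simp
        also have "\<dots> \<subseteq> span (ell ` ?P)"
        proof (rule span_minimal[OF _ subspace_span], clarify)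
          fix \<nu> assume \<nu>: "\<nu> \<in> set (paths t\<^sub>1)"
          have "E l\<^sub>1 t\<^sub>1 \<nu> = ell (l\<^sub>1 # \<nu>) - (\<Sum>(l, u)\<leftarrow>rest. E' l u \<nu>)"
            unfolding ell_first by simp
          moreover have "ell (l\<^sub>1 # \<nu>) \<in> span (ell ` ?P)"
            using P_I[OF first \<nu>] by (intro span_base) blast
          moreover have "(\<Sum>(l, u)\<leftarrow>rest. E' l u \<nu>) \<in> span (ell ` ?P)"
            using E'_S[OF _ \<nu>] S_ell by (intro span_sum_list) (clarify, blast)
          ultimately show "E l\<^sub>1 t\<^sub>1 \<nu> \<in> span (ell ` ?P)" using span_diff by metis
        qed
        finally show ?thesis .
      next
        case (2 l u \<mu>)
        have "x \<in> ?S l u" unfolding x 2(1) using 2(3) by (intro span_base) blast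
        then show ?thesis using S_ell[OF 2(2)] by blast
      qed
    qed
  next
    have "hd (paths (Inner c es)) = l\<^sub>1 # hd (paths t\<^sub>1)"
      using paths_nonempty[OF child[OF first]] by (cases "paths t\<^sub>1") (auto simp: es)
    moreover have "(\<Sum>(l, u)\<leftarrow>rest. E' l u (hd (paths t\<^sub>1))) =
        (\<Sum>(l, u)\<leftarrow>rest. \<Sum>\<mu>\<leftarrow>paths u. p (l # \<mu>))"
      using E' by (intro arg_cong[where f = sum_list] map_cong) auto
    ultimately show "ell (hd (paths (Inner c es))) = (\<Sum>\<pi>\<leftarrow>paths (Inner c es). p \<pi>)"
      using E[OF first] unfolding sum_list_paths_Inner es by (simp add: ell_first)
  qed
qed

end

section \<open>Elimination of the first labels\<close>

text \<open>
  A substitution that fixes every variable modulo an ideal fixes every polynomial modulo this ideal.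
  So a polynomial that it sends to 0 is congruent to 0.
\<close>

lemma elimination_ideal:
  assumes gens: "\<And>f. f \<in> S \<Longrightarrow> vars f \<subseteq> X \<and> poly_subst \<sigma> f = 0"
    and \<sigma>_vars: "\<And>v. v \<in> X \<Longrightarrow> vars (\<sigma> v) \<subseteq> X"
    and \<sigma>_cong: "\<And>v. v \<in> X \<Longrightarrow> Var v - \<sigma> v \<in> genideal (poly_ring X) S"
  shows "f \<in> genideal (poly_ring X) S \<longleftrightarrow> vars f \<subseteq> X \<and> poly_subst \<sigma> f = 0"
proof -
  let ?R = "poly_ring X" and ?I = "genideal (poly_ring X) S"
  interpret R: cring ?R by (rule poly_ring_cring)
  have S: "S \<subseteq> carrier ?R" using gens by auto
  interpret I: ideal ?I ?R by (rule R.genideal_ideal[OF S])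
  have "alg_hom X X (poly_subst \<sigma>)" by (rule alg_hom_poly_subst) (rule \<sigma>_vars)
  then have hom: "poly_subst \<sigma> \<in> ring_hom ?R ?R" unfolding alg_hom_def by blast
  interpret hom: ring_hom_ring ?R ?R "poly_subst \<sigma>"
    by (rule ring_hom_ringI2[OF R.ring_axioms R.ring_axioms hom])
  have carr: "vars h \<subseteq> X" if "h \<in> ?I" for h using I.Icarr[OF that] by simp
  have I_add: "g + h \<in> ?I" if "g \<in> ?I" "h \<in> ?I" for g h
    using I.a_closed[OF that] by simp
  have I_mult: "g * h \<in> ?I" if "g \<in> ?I" "vars h \<subseteq> X" for g h
    using I.I_r_closed[OF that(1), of h] that(2) by simp
  have cong: "h - poly_subst \<sigma> h \<in> ?I" if "vars h \<subseteq> X" for h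
    using that
  proof (induction rule: mpoly_induct)
    case (Const a)
    show ?case using I.zero_closed by simp
  next
    case (Var v)
    then show ?case using \<sigma>_cong by simp
  next
    case (add f h)
    then show ?case using I_add[OF add(3,4)] by (simp add: poly_subst_add algebra_simps)
  next
    case (mult f h)
    have "vars (poly_subst \<sigma> f) \<subseteq> X" 
      by (rule vars_poly_subst, rule \<sigma>_vars) (use mult(1) in blast)
    then have "(f - poly_subst \<sigma> f) * h + (h - poly_subst \<sigma> h) * poly_subst \<sigma> f \<in> ?I"
      using mult by (intro I_add I_mult)
    then show ?case by (simp add: poly_subst_mult algebra_simps)
  qed
  show ?thesis
  proof
    assume "f \<in> ?I"
    moreover have "?I \<subseteq> a_kernel ?R ?R (poly_subst \<sigma>)"
    proof (rule R.genideal_minimal[OF hom.kernel_is_ideal], rule subsetI)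
      fix h assume "h \<in> S"
      from gens[OF this] show "h \<in> a_kernel ?R ?R (poly_subst \<sigma>)"
        unfolding poly_ring_kernel_iff .
    qed
    ultimately have "f \<in> a_kernel ?R ?R (poly_subst \<sigma>)" by (rule rev_subsetD)
    then show "vars f \<subseteq> X \<and> poly_subst \<sigma> f = 0" unfolding poly_ring_kernel_iff .
  next
    assume "vars f \<subseteq> X \<and> poly_subst \<sigma> f = 0"
    then show "f \<in> ?I" using cong[of f] by simp
  qed
qed

lemma ideal_coset_eq_iff:
  assumes "ideal I R" "x \<in> carrier R"
  shows "I +>\<^bsub>R\<^esub> x = I \<longleftrightarrow> x \<in> I"
proof -
  interpret ideal I R by fact
  show ?thesis using a_rcos_const a_rcos_self[OF assms(2)] by metis
qed

text \<open>
  The description is unique for a first label \<open>l\<close> of a staged tree: \<open>l\<close> determines the stage, and the stage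
  determines the list of labels.
\<close>

definition sibling_labels :: "('c, 'l) tree \<Rightarrow> 'l \<Rightarrow> 'l list" where
  "sibling_labels T l =
     (THE ls. \<exists>c u es. Inner c ((l, u) # es) \<in> subtrees T \<and> ls = map fst es)"

text \<open>
  The solution of the sum-to-\<open>z\<close> condition of each stage for its first label. Different stages have
  disjoint labels, so the conditions can be solved independently of each other.
\<close>

definition eliminate :: "('c, 'l) tree \<Rightarrow> 'l indet \<Rightarrow> 'l indet mpoly" where
  "eliminate T x = (case x of
     Z \<Rightarrow> Var Z
   | Theta l \<Rightarrow> if l \<in> first_labels T
       then Var Z - (\<Sum>l'\<leftarrow>sibling_labels T l. Var (Theta l')) else Var (Theta l))"

context staged
begin

lemma sibling_labels_eq:
  assumes "Inner c ((l, u) # es) \<in> subtrees T"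
  shows "sibling_labels T l = map fst es"
  unfolding sibling_labels_def
proof (rule the_equality)
  fix ls assume "\<exists>c u es. Inner c ((l, u) # es) \<in> subtrees T \<and> ls = map fst es"
  then obtain c' u' es' where *: "Inner c' ((l, u') # es') \<in> subtrees T" "ls = map fst es'"
    by blast
  show "ls = map fst es" using shared_label_same_stage(2)[OF *(1) assms, of l] *(2) by simp
qed (use assms in blast)

lemma first_labelI: "Inner c ((l, u) # es) \<in> subtrees T \<Longrightarrow> l \<in> first_labels T"
  unfolding first_labels_def by force

lemma later_label_not_first:
  assumes "Inner c (e # es) \<in> subtrees T" "(l, u) \<in> set es"
  shows "l \<notin> first_labels T"
proof
  assume "l \<in> first_labels T"
  then obtain c' es' where es': "Inner c' es' \<in> subtrees T" "l = fst (hd es')"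
    unfolding first_labels_def by blast
  obtain e' es'' where eq: "es' = e' # es''" using inner_nonempty[OF es'(1)] by (cases es') auto
  have "l \<in> fst ` set es'" using es'(2) eq by simp
  moreover have "l \<in> fst ` set (e # es)" using assms(2) by (simp add: rev_image_eqI)
  ultimately have "map fst es' = map fst (e # es)"
    by (rule shared_label_same_stage(2)[OF es'(1) assms(1)])
  then have "l = fst e" using es'(2) eq by simp
  moreover have "l \<in> fst ` set es" using assms(2) by (simp add: rev_image_eqI)
  ultimately show False using labels_distinct[OF assms(1)] by simp
qed

lemma labelI: "Inner c es \<in> subtrees T \<Longrightarrow> (l, u) \<in> set es \<Longrightarrow> l \<in> labels T"
  unfolding labels_def by force

lemma eliminate_later:
  assumes "Inner c (e # es) \<in> subtrees T" "(l, u) \<in> set es"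
  shows "eliminate T (Theta l) = Var (Theta l)"
  using later_label_not_first[OF assms] by (simp add: eliminate_def)

lemma eliminate_first:
  assumes "Inner c ((l, u) # es) \<in> subtrees T"
  shows "eliminate T (Theta l) = Var Z - (\<Sum>(l', u')\<leftarrow>es. Var (Theta l'))"
  using first_labelI[OF assms] sibling_labels_eq[OF assms]
  by (simp add: eliminate_def o_def case_prod_unfold)

lemma sum_eliminate:
  assumes "Inner c es \<in> subtrees T"
  shows "(\<Sum>(l, u)\<leftarrow>es. eliminate T (Theta l)) = Var Z"
proof -
  obtain l u es' where es: "es = (l, u) # es'" using inner_nonempty[OF assms] by (cases es) auto
  have "(\<Sum>(l', u')\<leftarrow>es'. eliminate T (Theta l')) = (\<Sum>(l', u')\<leftarrow>es'. Var (Theta l'))"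
    using eliminate_later[OF assms[unfolded es]]
    by (intro arg_cong[where f = sum_list] map_cong) auto
  then show ?thesis using eliminate_first[OF assms[unfolded es]] by (simp add: es)
qed

lemma vars_labels_sum:
  assumes "Inner c es \<in> subtrees T" "set es' \<subseteq> set es"
  shows "vars (\<Sum>(l, u)\<leftarrow>es'. Var (Theta l)) \<subseteq> indets T"
  using assms labelI by (intro vars_sum_list) (auto simp: indets_def)

lemma first_label_cases:
  assumes "l \<in> first_labels T"
  obtains c u es where "Inner c ((l, u) # es) \<in> subtrees T"
proof -
  obtain c es where es: "Inner c es \<in> subtrees T" "l = fst (hd es)"
    using assms unfolding first_labels_def by blast
  show thesis using es inner_nonempty[OF es(1)] that by (cases es) auto
qed

lemma vars_eliminate:
  assumes "x \<in> indets T"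
  shows "vars (eliminate T x) \<subseteq> indets T"
proof (cases "\<exists>l. x = Theta l \<and> l \<in> first_labels T")
  case True
  then obtain l where x: "x = Theta l" and l: "l \<in> first_labels T" by blast
  obtain c u es where sub: "Inner c ((l, u) # es) \<in> subtrees T" by (rule first_label_cases[OF l])
  show ?thesis
    unfolding x eliminate_first[OF sub]
    by (rule vars_diff[OF _ vars_labels_sum[OF sub]]) (auto simp: indets_def)
next
  case False
  then have "eliminate T x = Var x" by (auto simp: eliminate_def split: indet.split)
  then show ?thesis using assms by simp
qed

lemma theta_ideal_iff: "f \<in> theta_ideal T \<longleftrightarrow> vars f \<subseteq> indets T \<and> poly_subst (eliminate T) f = 0"
  unfolding theta_ideal_def
proof (rule elimination_ideal)
  let ?S = "{(\<Sum>(l, t)\<leftarrow>es. Var (Theta l)) - Var Z |c es. Inner c es \<in> subtrees T}"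
  let ?I = "genideal (poly_ring (indets T)) ?S"
  have Z: "eliminate T Z = Var Z" by (simp add: eliminate_def)
  have gens: "vars f \<subseteq> indets T \<and> poly_subst (eliminate T) f = 0" if f_gen: "f \<in> ?S" for f
  proof -
    obtain c es where f: "f = (\<Sum>(l, t)\<leftarrow>es. Var (Theta l)) - Var Z"
      and es: "Inner c es \<in> subtrees T" using f_gen by blast
    show ?thesis
      using vars_diff[OF vars_labels_sum[OF es], of es "Var Z"] sum_eliminate[OF es]
      unfolding f poly_subst_diff poly_subst_sum_list
      by (simp add: Z case_prod_unfold) (simp add: indets_def)
  qed
  then show "\<And>f. f \<in> ?S \<Longrightarrow> vars f \<subseteq> indets T \<and> poly_subst (eliminate T) f = 0" .
  show "\<And>x. x \<in> indets T \<Longrightarrow> vars (eliminate T x) \<subseteq> indets T" by (rule vars_eliminate)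
  fix x assume x: "x \<in> indets T"
  interpret R: cring "poly_ring (indets T)" by (rule poly_ring_cring)
  have S: "?S \<subseteq> carrier (poly_ring (indets T))" using gens by (simp only: carrier_poly_ring subset_iff) blast
  interpret I: ideal ?I "poly_ring (indets T)" by (rule R.genideal_ideal[OF S])
  show "Var x - eliminate T x \<in> ?I"
  proof (cases "\<exists>l. x = Theta l \<and> l \<in> first_labels T")
    case True
    then obtain l where x: "x = Theta l" and l: "l \<in> first_labels T" by blast
    obtain c u es where sub: "Inner c ((l, u) # es) \<in> subtrees T" by (rule first_label_cases[OF l])
    have "(\<Sum>(l, t)\<leftarrow>(l, u) # es. Var (Theta l)) - Var Z \<in> ?I"
      using R.genideal_self[OF S] sub by blast
    then show ?thesis unfolding x eliminate_first[OF sub] by (simp add: algebra_simps)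
  next
    case False
    then have "eliminate T x = Var x" by (auto simp: eliminate_def split: indet.split)
    then show ?thesis using I.zero_closed by simp
  qed
qed

lemma path_labels: "t \<in> subtrees T \<Longrightarrow> \<pi> \<in> set (paths t) \<Longrightarrow> set \<pi> \<subseteq> labels T"
proof (induction arbitrary: \<pi> rule: subtrees_induct_down)
  case (Inner c es)
  from Inner(3) obtain l u \<mu> where "(l, u) \<in> set es" "\<mu> \<in> set (paths u)" "\<pi> = l # \<mu>"
    unfolding set_paths_Inner by blast
  then show ?case using Inner(2) labelI[OF Inner(1)] by fastforce
qed simp

lemma vars_path_monomial:
  assumes "r < num_leaves T"
  shows "vars (path_monomial T r) \<subseteq> indets T"
proof -
  have "set (paths T ! r) \<subseteq> labels T"
    by (rule path_labels[OF subtrees.root]) (use assms in \<open>simp add: num_leaves_def\<close>)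
  then show ?thesis
    unfolding path_monomial_def
    by (intro vars_mult vars_power vars_prod_list) (auto simp: indets_def)
qed

text \<open>
  Elimination turns the map to the quotient ring into a substitution with polynomial values, whose
  kernel no longer refers to an ideal.
\<close>

lemma tree_kernel_eq:
  "tree_kernel T = a_kernel (poly_ring {..<num_leaves T}) (poly_ring (indets T))
     (poly_subst (\<lambda>r. poly_subst (eliminate T) (path_monomial T r)))"
proof -
  interpret R: cring "poly_ring (indets T)" by (rule poly_ring_cring)
  have ideal: "ideal (theta_ideal T) (poly_ring (indets T))"
    unfolding theta_ideal_def
  proof (rule R.genideal_ideal, clarify)
    fix c es assume es: "Inner c es \<in> subtrees T"
    show "(\<Sum>(l, t)\<leftarrow>es. Var (Theta l)) - Var Z \<in> carrier (poly_ring (indets T))"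
      unfolding carrier_poly_ring
      by (rule vars_diff[OF vars_labels_sum[OF es]]) (auto simp: indets_def)
  qed
  have coset: "tree_map T f = theta_ideal T \<longleftrightarrow>
      poly_subst (\<lambda>r. poly_subst (eliminate T) (path_monomial T r)) f = 0"
    if "vars f \<subseteq> {..<num_leaves T}" for f
  proof -
    have "vars (poly_subst (path_monomial T) f) \<subseteq> indets T"
      by (rule vars_poly_subst, rule vars_path_monomial) (use that in auto)
    then show ?thesis
      using ideal_coset_eq_iff[OF ideal] theta_ideal_iff poly_subst_poly_subst
      unfolding tree_map_def by (metis carrier_poly_ring)
  qed
  show ?thesis
  proof (rule Set.set_eqI)
    fix f
    show "f \<in> tree_kernel T \<longleftrightarrow> f \<in> a_kernel (poly_ring {..<num_leaves T}) (poly_ring (indets T))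
        (poly_subst (\<lambda>r. poly_subst (eliminate T) (path_monomial T r)))"
      using coset[of f] unfolding tree_kernel_def poly_ring_kernel_iff
      unfolding a_kernel_def' by (auto simp: FactRing_def)
  qed
qed

end

section \<open>Bases of the space of linear forms\<close>

text \<open>
  A maximal independent subset of the family still spans, so it has at least \<open>n\<close> members and leaves no
  room for repeated or dependent ones.
\<close>

lemma (in vector_space) spanning_family_independent:
  assumes "independent B" "finite B" "card B = n" "span (f ` {..<n}) = span B"
  shows "inj_on f {..<n} \<and> independent (f ` {..<n})"
proof -
  obtain C where C: "C \<subseteq> f ` {..<n}" "independent C" "f ` {..<n} \<subseteq> span C"
    using maximal_independent_subset by blast
  have "finite C" using C(1) finite_subset by blast
  have "B \<subseteq> span (f ` {..<n})" unfolding assms(4) by (rule span_superset)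
  also have "\<dots> \<subseteq> span C" by (rule span_minimal[OF C(3) subspace_span])
  finally have "n \<le> card C"
    using independent_span_bound[OF \<open>finite C\<close> assms(1)] assms(3) by blast
  moreover have "card C \<le> card (f ` {..<n})" using C(1) by (intro card_mono) auto
  moreover have "card (f ` {..<n}) \<le> n" using card_image_le[of "{..<n}" f] by simp
  ultimately have "card C = card (f ` {..<n})" "card (f ` {..<n}) = card {..<n}" by simp_all
  then have "C = f ` {..<n}" "inj_on f {..<n}"
    using C(1) card_subset_eq[of "f ` {..<n}" C] eq_card_imp_inj_on[of "{..<n}" f] by simp_all
  then show ?thesis using C(2) by simp
qed

lemma lookup_Const_mult: "Poly_Mapping.lookup (Const a * f) m = a * Poly_Mapping.lookup f m"
  unfolding Const_def mult_map_scale_conv_mult[symmetric]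
  by (simp add: Poly_Mapping.map.rep_eq when_def)

lemma lookup_Var: "Poly_Mapping.lookup (Var v) (Poly_Mapping.single w (Suc 0)) = (if v = w then 1 else 0)"
proof -
  have "Poly_Mapping.single v (Suc 0) = Poly_Mapping.single w (Suc 0) \<longleftrightarrow> v = w"
    by (metis keys_single singleton_inject Zero_not_Suc)
  then show ?thesis by (simp add: Var_def lookup_single when_def)
qed

lemma inj_Var: "inj Var"
  by (rule injI) (metis lookup_Var zero_neq_one)

text \<open>
  The coefficient of \<open>v\<close> is a linear functional that is 1 on \<open>Var v\<close> and 0 on the other variables.
\<close>

lemma independent_Var: "mpoly.independent (Var ` A)"
  unfolding mpoly.dependent_def
proof clarify
  fix v assume "v \<in> A" and span: "Var v \<in> mpoly.span (Var ` A - {Var v})"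
  let ?V = "{f. Poly_Mapping.lookup f (Poly_Mapping.single v (Suc 0)) = (0::real)}"
  have "mpoly.subspace ?V"
    by (simp add: mpoly.subspace_def lookup_add lookup_Const_mult)
  moreover have "Var ` A - {Var v} \<subseteq> ?V" by (auto simp: lookup_Var)
  ultimately have "Var v \<in> ?V" using span mpoly.span_minimal by blast
  then show False by (simp add: lookup_Var)
qed

section \<open>The toric change of variables\<close>

theorem theorem5p3:
  fixes T :: "('c, 'l) tree"
  assumes "SIP_tree T"
    and "\<forall>c\<in>inner_stages T. SIP_index T c 0"
  shows "\<exists>ell :: nat \<Rightarrow> nat mpoly.
      basis_family (num_leaves T) ell (linear_forms {..<num_leaves T}) \<and>
      (\<exists>\<psi>. alg_hom {..<num_leaves T} (indets T) \<psi> \<and>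
         (\<forall>r<num_leaves T. \<psi> (ell r) = toric_monomial T r) \<and>
         tree_kernel T = a_kernel (poly_ring {..<num_leaves T}) (poly_ring (indets T)) \<psi>) \<and>
      (\<exists>r<num_leaves T. ell r = (\<Sum>s<num_leaves T. Var s))"
proof -
  interpret staged T using assms(1) unfolding SIP_tree_def by unfold_locales blast
  let ?n = "num_leaves T" and ?P = "set (paths T)"
  define s where "s l = eliminate T (Theta l)" for l
  define \<tau> where "\<tau> l = (if l \<in> first_labels T then Var Z else Var (Theta l))" for l
  define q where "q r = poly_subst (eliminate T) (path_monomial T r)" for r
  have q: "q r = path_value (Var Z) s (depth T) (paths T ! r)" for r
    by (simp add: q_def path_monomial_def path_value_def s_def poly_subst_mult poly_subst_power
        poly_subst_prod_list) (simp add: eliminate_def)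
  have toric: "toric_monomial T r = path_value (Var Z) \<tau> (depth T) (paths T ! r)" for r
    by (simp add: toric_monomial_def path_monomial_def path_value_def \<tau>_def poly_subst_mult
        poly_subst_power poly_subst_prod_list image_iff)
  \<comment> \<open>The map \<open>F\<close> is the substitution whose kernel is sought. It serves as the map \<open>\<psi>\<close> of the claim.\<close>
  interpret sip_evaluation T "\<lambda>a (f :: nat mpoly). Const a * f" "poly_subst q" "Var Z" s \<tau>
  proof unfold_locales
    fix c l u es l\<^sub>1 t\<^sub>1
    assume sub: "Inner c ((l\<^sub>1, t\<^sub>1) # es) \<in> subtrees T" and lu: "(l, u) \<in> set es"
    have "SIP_index T c 0" using assms(2) sub unfolding inner_stages_def by blast
    then have "\<forall>(l, t)\<in>set ((l\<^sub>1, t\<^sub>1) # es). contains_at_root t (snd (((l\<^sub>1, t\<^sub>1) # es) ! 0))"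
      using sub unfolding SIP_index_def by blast
    then show "contains_at_root u t\<^sub>1" using lu by auto
  next
    fix c e es l u assume "Inner c (e # es) \<in> subtrees T" "(l, u) \<in> set es"
    then show "\<tau> l = s l" using later_label_not_first eliminate_later by (simp add: \<tau>_def s_def)
  qed (simp_all add: poly_subst_add sum_eliminate s_def \<tau>_def first_labelI)
  \<comment> \<open>The induction indexes forms by paths; distinctness of the paths translates this to leaf numbers.\<close>
  define p :: "'l list \<Rightarrow> nat mpoly" where "p \<pi> = Var (THE r. r < ?n \<and> paths T ! r = \<pi>)" for \<pi>
  have p: "p (paths T ! r) = Var r" if "r < ?n" for r
  proof -
    have "(THE r'. r' < ?n \<and> paths T ! r' = paths T ! r) = r"
      using that paths_distinct[OF subtrees.root]
      by (intro the_equality) (auto simp: num_leaves_def nth_eq_iff_index_eq)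
    then show ?thesis by (simp add: p_def)
  qed
  have P_image: "f ` ?P = (\<lambda>r. f (paths T ! r)) ` {..<?n}" for f :: "'l list \<Rightarrow> nat mpoly"
    by (auto simp: num_leaves_def set_conv_nth)
  have p_image: "p ` ?P = Var ` {..<?n}"
    unfolding P_image using p by (intro image_cong) auto
  have short: "\<forall>\<pi>\<in>?P. length \<pi> \<le> depth T" by (simp add: depth_def)
  have "evaluates s T (depth T) 1 p"
    unfolding evaluates_def
  proof
    fix \<pi> assume "\<pi> \<in> ?P"
    then obtain r where "r < ?n" "\<pi> = paths T ! r" by (auto simp: num_leaves_def in_set_conv_nth)
    then show "poly_subst q (p \<pi>) = 1 * path_value (Var Z) s (depth T) \<pi>" using p q by simp
  qed
  then obtain e where e: "evaluates \<tau> T (depth T) 1 e" "mpoly.span (e ` ?P) = mpoly.span (p ` ?P)"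
      "e (hd (paths T)) = (\<Sum>\<pi>\<leftarrow>paths T. p \<pi>)"
    using monomial_forms[OF subtrees.root short] by blast
  define ell where "ell r = e (paths T ! r)" for r
  have ell_image: "ell ` {..<?n} = e ` ?P" unfolding P_image ell_def ..
  have "inj_on ell {..<?n} \<and> mpoly.independent (ell ` {..<?n})"
  proof (rule mpoly.spanning_family_independent[OF independent_Var])
    show "card (Var ` {..<?n} :: nat mpoly set) = ?n"
      using card_image[OF inj_on_subset[OF inj_Var subset_UNIV], of "{..<?n}"] by simp
    show "mpoly.span (ell ` {..<?n}) = mpoly.span (Var ` {..<?n})"
      unfolding ell_image e(2) p_image ..
  qed simp
  then have "basis_family ?n ell (linear_forms {..<?n})"
    unfolding basis_family_def linear_forms_def ell_image e(2) p_image by simp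
  moreover have "alg_hom {..<?n} (indets T) (poly_subst q)"
    unfolding q_def
    by (intro alg_hom_poly_subst vars_poly_subst vars_eliminate) (use vars_path_monomial in blast)
  moreover have "\<forall>r<?n. poly_subst q (ell r) = toric_monomial T r"
    unfolding toric ell_def using evaluatesD[OF e(1)] by (simp add: num_leaves_def)
  moreover have "tree_kernel T = a_kernel (poly_ring {..<?n}) (poly_ring (indets T)) (poly_subst q)"
    unfolding tree_kernel_eq q_def ..
  \<comment> \<open>Leaf number 0 lies on the path of first labels, whose form is the sum of all variables.\<close>
  moreover have "0 < ?n" using paths_nonempty[OF subtrees.root] by (simp add: num_leaves_def)
  moreover have "ell 0 = (\<Sum>s<?n. Var s)"
  proof -
    have "ell 0 = (\<Sum>\<pi>\<leftarrow>paths T. p \<pi>)"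
      using e(3) paths_nonempty[OF subtrees.root] by (simp add: ell_def hd_conv_nth)
    also have "\<dots> = (\<Sum>r<?n. p (paths T ! r))"
      by (simp add: sum_list_sum_nth num_leaves_def atLeast0LessThan)
    also have "\<dots> = (\<Sum>s<?n. Var s)" using p by (intro sum.cong) auto
    finally show ?thesis .
  qed
  ultimately show ?thesis by blast
qed

end
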